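(* Let $\mathfrak q\in\mathbb{R}^{4,1}\setminus\{0\}$ and let $\mathfrak s:\mathbb{Z}^2\to\mathfrak Q^3$ be a discrete isothermic net in the quadric $\mathfrak Q^3$ of constant curvature $\kappa=-(\mathfrak q,\mathfrak q)$, having constant mean curvature $H\in\mathbb{R}$ with respect to a Gauss map $\mathfrak n$, that is, $A(\mathfrak n,\mathfrak s)+H\,A(\mathfrak s,\mathfrak s)=0$ on every face. Then its mean curvature sphere congruence $z=\mathbb{R}\,\mathfrak z$, where $\mathfrak z=\mathfrak n+H\mathfrak s$, projects to a Königs dual net $\mathfrak s^\ast=\mathfrak z$ of $\mathfrak s$ that takes values in a concentric quadric $\mathfrak Q^3_{r,t}$ for some $r,t\in\mathbb{R}$.
   Context: $\mathbb{R}^{4,1}$ is $\mathbb{R}^5$ with a Minkowski inner product $(\cdot,\cdot)$ of signature $(4,1)$. Put $\mathcal L^4_t=\{y\in\mathbb{R}^{4,1}: (y,y)=t\}$, $\mathcal L^4=\mathcal L^4_0$, and, for fixed $\mathfrak q\neq0$, $\mathfrak E^4_r=\{y\in\mathbb{R}^{4,1}:(y,\mathfrak q)=r\}$, $\mathfrak E^4=\mathfrak E^4_1$. The quadric of constant curvature is $\mathfrak Q^3=\mathcal L^4\cap\mathfrak E^4$; its concentric quadrics are $\mathfrak Q^3_{r,t}=\mathcal L^4_t\cap\mathfrak E^4_r$. A discrete conjugate net is a map on $\mathbb{Z}^2$ such that the four vertices of each elementary quadrilateral (face) $(ijkl)$, with vertices listed cyclically, are coplanar. A discrete Königs net is a discrete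 conjugate net such that at each vertex the four intersection points of the diagonals of the four incident faces are coplanar. A discrete net in $\mathfrak Q^3$ (equivalently, in $P(\mathcal L^4)\subset\mathbb{R}P^4$) is called isothermic if it is a discrete Königs net. For a vector valued map $g$ on $\mathbb{Z}^2$ write $dg_{ij}=g_j-g_i$ for edges $(ij)$ and $\delta g_{ik}=g_k-g_i$ for diagonals. Two conjugate nets $\mathfrak s,\mathfrak s^\ast$, in the same or in parallel affine spaces, are Königs dual if they are edge-parallel and have parallel non-corresponding diagonals, that is, $d\mathfrak s^\ast_{ij}\wedge d\mathfrak s_{ij}=0$ on all edges, and $\delta\mathfrak s^\ast_{ik}\wedge\delta\mathfrak s_{jl}=0$ and $\delta\mathfrak s_{ik}\wedge\delta\mathfrak s^\ast_{jl}=0$ on all faces. The mixed area of two edge-parallel nets on a face is $A(\mathfrak s,\mathfrak n)_{ijkl}=\frac14\{\delta\mathfrak s_{ik}\wedge\delta\mathfrak n_{jl}+\delta\mathfrak n_{ik}\wedge\delta\mathfrak s_{jl}\}\in\Lambda^2\mathbb{R}^{4,1}$. A Gauss map of $\mathfrak s:\mathbb{Z}^2\to\mathfrak Q^3$ is a map $\mathfrak n:\mathbb{Z}^2\to\mathbb{R}^{4,1}$ with $(\mathfrak n,\mathfrak n)\equiv1$, $\mathfrak n_i\in T_{\mathfrak s_i}\mathfrak Q^3=\{\mathfrak s_i,\mathfrak q\}^\perp$ at all vertices, and $d\mathfrak n_{ij}+k_{ij}\,d\mathfrak s_{ij}=0$ on every edge for some $k_{ij}\in\mathbb{R}$. *)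

theory Defs
  imports "HOL-Analysis.Analysis"
begin

(* Signature (4,1) is expressed by an orthonormal basis with exactly one timelike vector;
   linear independence of e follows from the orthogonality relations. *)
definition minkowski_form :: "(real^5 \<Rightarrow> real^5 \<Rightarrow> real) \<Rightarrow> bool" where
  "minkowski_form ip \<longleftrightarrow>
     bilinear ip \<and> (\<forall>x y. ip x y = ip y x) \<and>
     (\<exists>e :: 5 \<Rightarrow> real^5. \<forall>a b. ip (e a) (e b) = (if a \<noteq> b then 0 else if a = 5 then -1 else 1))"

definition lorentz_quadric :: "(real^5 \<Rightarrow> real^5 \<Rightarrow> real) \<Rightarrow> real \<Rightarrow> (real^5) set" where
  "lorentz_quadric ip t = {y. ip y y = t}"

definition affine_hyperplane :: "(real^5 \<Rightarrow> real^5 \<Rightarrow> real) \<Rightarrow> real^5 \<Rightarrow> real \<Rightarrow> (real^5) set" where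
  "affine_hyperplane ip q r = {y. ip y q = r}"

definition concentric_quadric ::
  "(real^5 \<Rightarrow> real^5 \<Rightarrow> real) \<Rightarrow> real^5 \<Rightarrow> real \<Rightarrow> real \<Rightarrow> (real^5) set" where
  "concentric_quadric ip q r t = lorentz_quadric ip t \<inter> affine_hyperplane ip q r"

(* The quadric of constant curvature - ip q q. *)
definition space_form :: "(real^5 \<Rightarrow> real^5 \<Rightarrow> real) \<Rightarrow> real^5 \<Rightarrow> (real^5) set" where
  "space_form ip q = lorentz_quadric ip 0 \<inter> affine_hyperplane ip q 1"

definition orth_compl :: "(real^5 \<Rightarrow> real^5 \<Rightarrow> real) \<Rightarrow> (real^5) set \<Rightarrow> (real^5) set" where
  "orth_compl ip S = {y. \<forall>x\<in>S. ip y x = 0}"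

definition tangent_space ::
  "(real^5 \<Rightarrow> real^5 \<Rightarrow> real) \<Rightarrow> real^5 \<Rightarrow> real^5 \<Rightarrow> (real^5) set" where
  "tangent_space ip q p = orth_compl ip {p, q}"

(* The second exterior power of real^5 is modelled by antisymmetric matrices. *)
definition wedge :: "real^5 \<Rightarrow> real^5 \<Rightarrow> real^5^5" (infixl "\<and>\<and>" 70) where
  "x \<and>\<and> y = (\<chi> a b. x $ a * y $ b - x $ b * y $ a)"

type_synonym vertex = "int \<times> int"
type_synonym net = "vertex \<Rightarrow> real^5"

(* One orientation per edge, and one starting vertex and orientation per face, suffice:
   every condition below is invariant under the other choices. *)
definition edge :: "vertex \<Rightarrow> vertex \<Rightarrow> bool" where
  "edge i j \<longleftrightarrow> j = i + (1, 0) \<or> j = i + (0, 1)"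

definition face :: "vertex \<Rightarrow> vertex \<Rightarrow> vertex \<Rightarrow> vertex \<Rightarrow> bool" where
  "face i j k l \<longleftrightarrow> j = i + (1, 0) \<and> k = i + (1, 1) \<and> l = i + (0, 1)"

(* Written dg_ij on edges and delta g_ik on diagonals. *)
definition diff :: "net \<Rightarrow> vertex \<Rightarrow> vertex \<Rightarrow> real^5" where
  "diff g i j = g j - g i"

definition conjugate_net :: "net \<Rightarrow> bool" where
  "conjugate_net f \<longleftrightarrow> (\<forall>i j k l. face i j k l \<longrightarrow> coplanar {f i, f j, f k, f l})"

(* Diagonals are intersected in the projective closure of the affine space, since they may be
   parallel: a point x has homogeneous coordinates (x, 1), and p is a homogeneous coordinate
   vector of a common point of the two diagonals. *)
definition diagonal_point :: "net \<Rightarrow> vertex \<Rightarrow> vertex \<Rightarrow> vertex \<Rightarrow> vertex \<Rightarrow> (real^5) \<times> real \<Rightarrow> bool" where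
  "diagonal_point f i j k l p \<longleftrightarrow>
     p \<noteq> 0 \<and> p \<in> span {(f i, 1), (f k, 1)} \<and> p \<in> span {(f j, 1), (f l, 1)}"

(* In homogeneous coordinates, coplanarity of points means that the coordinate vectors span
   a subspace of dimension at most 3. The faces incident with v are those whose first vertex
   is v, v - (1,0), v - (1,1) or v - (0,1). *)
definition koenigs_net :: "net \<Rightarrow> bool" where
  "koenigs_net f \<longleftrightarrow> conjugate_net f \<and>
     (\<forall>v. \<exists>p1 p2 p3 p4.
        diagonal_point f v (v + (1, 0)) (v + (1, 1)) (v + (0, 1)) p1 \<and>
        diagonal_point f (v + (-1, 0)) v (v + (0, 1)) (v + (-1, 1)) p2 \<and>
        diagonal_point f (v + (-1, -1)) (v + (0, -1)) v (v + (-1, 0)) p3 \<and>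
        diagonal_point f (v + (0, -1)) (v + (1, -1)) (v + (1, 0)) v p4 \<and>
        dim {p1, p2, p3, p4} \<le> 3)"

definition isothermic_net :: "(real^5 \<Rightarrow> real^5 \<Rightarrow> real) \<Rightarrow> real^5 \<Rightarrow> net \<Rightarrow> bool" where
  "isothermic_net ip q s \<longleftrightarrow> (\<forall>i. s i \<in> space_form ip q) \<and> koenigs_net s"

definition edge_parallel :: "net \<Rightarrow> net \<Rightarrow> bool" where
  "edge_parallel f g \<longleftrightarrow> (\<forall>i j. edge i j \<longrightarrow> diff g i j \<and>\<and> diff f i j = 0)"

definition koenigs_dual :: "net \<Rightarrow> net \<Rightarrow> bool" where
  "koenigs_dual f g \<longleftrightarrow> conjugate_net f \<and> conjugate_net g \<and> edge_parallel f g \<and>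
     (\<forall>i j k l. face i j k l \<longrightarrow>
        diff g i k \<and>\<and> diff f j l = 0 \<and> diff f i k \<and>\<and> diff g j l = 0)"

definition mixed_area :: "net \<Rightarrow> net \<Rightarrow> vertex \<Rightarrow> vertex \<Rightarrow> vertex \<Rightarrow> vertex \<Rightarrow> real^5^5" where
  "mixed_area f g i j k l =
     (1/4) *\<^sub>R (diff f i k \<and>\<and> diff g j l + diff g i k \<and>\<and> diff f j l)"

definition gauss_map :: "(real^5 \<Rightarrow> real^5 \<Rightarrow> real) \<Rightarrow> real^5 \<Rightarrow> net \<Rightarrow> net \<Rightarrow> bool" where
  "gauss_map ip q s n \<longleftrightarrow>
     (\<forall>i. ip (n i) (n i) = 1 \<and> n i \<in> tangent_space ip q (s i)) \<and>
     (\<forall>i j. edge i j \<longrightarrow> (\<exists>k. diff n i j + k *\<^sub>R diff s i j = 0))"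

definition constant_mean_curvature :: "net \<Rightarrow> net \<Rightarrow> real \<Rightarrow> bool" where
  "constant_mean_curvature s n H \<longleftrightarrow>
     (\<forall>i j k l. face i j k l \<longrightarrow> mixed_area n s i j k l + H *\<^sub>R mixed_area s s i j k l = 0)"

(* A map into the projective space is given by its values as linear subspaces. *)
definition mean_curvature_sphere_congruence :: "net \<Rightarrow> net \<Rightarrow> real \<Rightarrow> vertex \<Rightarrow> (real^5) set" where
  "mean_curvature_sphere_congruence s n H i = span {n i + H *\<^sub>R s i}"

definition homogeneous_lift :: "(vertex \<Rightarrow> (real^5) set) \<Rightarrow> net \<Rightarrow> bool" where
  "homogeneous_lift Z f \<longleftrightarrow> (\<forall>i. f i \<noteq> 0 \<and> Z i = span {f i})"

end

(* For edge-parallel nets the two terms of the mixed area on a face agree, because both nets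
   close up around the face. Constant mean curvature says that the mixed area of s and
   z = n + H s vanishes, so both terms vanish, which is Koenigs duality. The remaining claims
   follow from (z,z) = 1 and (z,q) = H. *)
theory Submission
  imports Defs
begin

text \<open>All differences of the points \<open>p\<close> lie in the direction space of a common
  plane. Multiples of these differences stay in it, and the three given edges connect
  \<open>p' i\<close> to the other three vertices, so the points \<open>p'\<close> lie in the
  translate of that direction space through \<open>p' i\<close>.\<close>

lemma coplanar_edge_multiples:
  fixes p p' :: "'a \<Rightarrow> 'b::real_vector"
  assumes "coplanar {p i, p j, p k, p l}"
    and "p' j - p' i = a *\<^sub>R (p j - p i)"
    and "p' k - p' j = b *\<^sub>R (p k - p j)"
    and "p' l - p' i = c *\<^sub>R (p l - p i)"
  shows "coplanar {p' i, p' j, p' k, p' l}"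
proof -
  obtain u v w where uvw: "{p i, p j, p k, p l} \<subseteq> affine hull {u, v, w}"
    using assms(1) unfolding coplanar_def by blast
  let ?V = "span {v - u, w - u}"
  \<comment> \<open>Used twice: at \<open>u\<close> for the plane of \<open>p\<close>, at
    \<open>p' i\<close> for the parallel plane containing \<open>p'\<close>.\<close>
  have hull: "affine hull {x, x + (v - u), x + (w - u)} = (+) x ` ?V" for x
    by (simp add: affine_hull_insert_span_gen)
  have "{p i, p j, p k, p l} \<subseteq> (+) u ` ?V"
    using uvw hull[of u] by simp
  then have u: "x - u \<in> ?V" if "x \<in> {p i, p j, p k, p l}" for x
    using that by (auto simp: subset_iff)
  have V: "x - y \<in> ?V" if "x \<in> {p i, p j, p k, p l}" "y \<in> {p i, p j, p k, p l}" for x y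
    using span_diff[OF u[OF that(1)] u[OF that(2)]] by simp
  have j: "p' j - p' i \<in> ?V" and kj: "p' k - p' j \<in> ?V" and l: "p' l - p' i \<in> ?V"
    unfolding assms(2-4) by (intro span_scale V; simp)+
  have k: "p' k - p' i \<in> ?V"
    using span_add[OF kj j] by simp
  have "y \<in> (+) (p' i) ` ?V" if "y - p' i \<in> ?V" for y
    using that by (rule rev_image_eqI) simp
  then have "{p' i, p' j, p' k, p' l} \<subseteq> (+) (p' i) ` ?V"
    using j k l by (simp add: span_zero)
  then show ?thesis
    unfolding coplanar_def hull[symmetric] by blast
qed

text \<open>Move \<open>f i\<close> and \<open>g i\<close> to the origin. Then
  \<open>g j \<and>\<and> f j = 0\<close>, and expanding
  \<open>(g k - g j) \<and>\<and> (f k - f j) = 0\<close> gives \<open>g k \<and>\<and> f k = g k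
  \<and>\<and> f j - f k \<and>\<and> g j\<close>. The same holds with \<open>l\<close> for
  \<open>j\<close>; subtracting the two yields the claim.\<close>

lemma edge_parallel_mixed_terms_eq:
  assumes "diff g i j = a *\<^sub>R diff f i j"
    and "diff g j k = b *\<^sub>R diff f j k"
    and "diff g l k = c *\<^sub>R diff f l k"
    and "diff g i l = d *\<^sub>R diff f i l"
  shows "diff g i k \<and>\<and> diff f j l = diff f i k \<and>\<and> diff g j l"
proof -
  have coords: "g j $ x - g i $ x = a * (f j $ x - f i $ x)"
    "g k $ x - g j $ x = b * (f k $ x - f j $ x)"
    "g k $ x - g l $ x = c * (f k $ x - f l $ x)"
    "g l $ x - g i $ x = d * (f l $ x - f i $ x)" for x
    using assms by (auto simp: diff_def vec_eq_iff)
  \<comment> \<open>One entry of the antisymmetric matrices: the factors \<open>a\<close>,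
    \<open>b\<close>, \<open>c\<close>, \<open>d\<close> are shared by the coordinates
    \<open>x\<close> and \<open>y\<close>, so the edge equations for both imply the
    identity.\<close>
  have "(g k $ x - g i $ x) * (f l $ y - f j $ y) - (g k $ y - g i $ y) * (f l $ x - f j $ x)
      = (f k $ x - f i $ x) * (g l $ y - g j $ y) - (f k $ y - f i $ y) * (g l $ x - g j $ x)"
    for x y
    using coords[of x] coords[of y] by algebra
  then show ?thesis
    by (simp add: wedge_def diff_def vec_eq_iff)
qed

lemma mixed_area_add_scaleR_left:
  "mixed_area (\<lambda>v. f v + t *\<^sub>R g v) h i j k l
     = mixed_area f h i j k l + t *\<^sub>R mixed_area g h i j k l"
  by (simp add: mixed_area_def wedge_def diff_def vec_eq_iff field_simps)

text \<open>Parallelism is assumed with explicit factors, since a vanishing wedge product would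
  leave an edge of \<open>g\<close> arbitrary wherever the edge of \<open>f\<close> degenerates, and
  \<open>g\<close> could then fail to be conjugate.\<close>

lemma edge_parallel_imp_koenigs_dual:
  assumes "conjugate_net f"
    and parallel: "\<And>i j. edge i j \<Longrightarrow> \<exists>c. diff g i j = c *\<^sub>R diff f i j"
    and area: "\<And>i j k l. face i j k l \<Longrightarrow> mixed_area g f i j k l = 0"
  shows "koenigs_dual f g"
proof -
  have face_parallel: "\<exists>a b c d. diff g i j = a *\<^sub>R diff f i j \<and> diff g j k = b *\<^sub>R diff f j k \<and>
      diff g l k = c *\<^sub>R diff f l k \<and> diff g i l = d *\<^sub>R diff f i l"
    if "face i j k l" for i j k l
  proof -
    \<comment> \<open>\<open>edge\<close> admits only the positive directions, hence
      \<open>l k\<close> and \<open>i l\<close> rather than the cyclic orientation.\<close>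
    have "edge i j" "edge j k" "edge l k" "edge i l"
      using that by (auto simp: face_def edge_def add.assoc)
    then show ?thesis
      using parallel by meson
  qed
  have "conjugate_net g"
    unfolding conjugate_net_def
  proof (intro allI impI)
    fix i j k l
    assume F: "face i j k l"
    then have "coplanar {f i, f j, f k, f l}"
      using assms(1) unfolding conjugate_net_def by blast
    moreover obtain a b d where "diff g i j = a *\<^sub>R diff f i j" "diff g j k = b *\<^sub>R diff f j k"
      "diff g i l = d *\<^sub>R diff f i l"
      using face_parallel[OF F] by blast
    ultimately show "coplanar {g i, g j, g k, g l}"
      unfolding diff_def by (rule coplanar_edge_multiples)
  qed
  moreover have "edge_parallel f g"
    unfolding edge_parallel_def
  proof (intro allI impI)
    fix i j
    assume "edge i j"
    then obtain c where "diff g i j = c *\<^sub>R diff f i j"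
      using parallel by blast
    then show "diff g i j \<and>\<and> diff f i j = 0"
      by (simp add: wedge_def vec_eq_iff)
  qed
  moreover have "diff g i k \<and>\<and> diff f j l = 0 \<and> diff f i k \<and>\<and> diff g j l = 0"
    if F: "face i j k l" for i j k l
  proof -
    have "diff g i k \<and>\<and> diff f j l = diff f i k \<and>\<and> diff g j l"
      using face_parallel[OF F] edge_parallel_mixed_terms_eq by blast
    moreover have "diff g i k \<and>\<and> diff f j l + diff f i k \<and>\<and> diff g j l = 0"
      using area[OF F] by (simp add: mixed_area_def)
    ultimately show ?thesis
      by (simp flip: scaleR_2)
  qed
  ultimately show ?thesis
    using assms(1) by (simp add: koenigs_dual_def)
qed

theorem mainTheorem2:
  fixes ip :: "real^5 \<Rightarrow> real^5 \<Rightarrow> real"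
    and q :: "real^5"
    and s n :: net
    and H :: real
  assumes "minkowski_form ip"
    and "q \<noteq> 0"
    and "isothermic_net ip q s"
    and "gauss_map ip q s n"
    and "constant_mean_curvature s n H"
  shows "let z = (\<lambda>i. n i + H *\<^sub>R s i) in
           homogeneous_lift (mean_curvature_sphere_congruence s n H) z \<and>
           koenigs_dual s z \<and>
           (\<exists>r t. \<forall>i. z i \<in> concentric_quadric ip q r t)"
proof -
  define z where "z = (\<lambda>i. n i + H *\<^sub>R s i)"
  have bil: "bilinear ip" and sym: "ip x y = ip y x" for x y
    using assms(1) by (auto simp: minkowski_form_def)
  note bilinear_simps = bilinear_ladd[OF bil] bilinear_radd[OF bil]
    bilinear_lmul[OF bil] bilinear_rmul[OF bil]
  \<comment> \<open>Splitting quantifiers over vertices into pairs of integers would keep the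
    assumption from matching \<open>s i\<close>.\<close>
  have s: "ip (s i) (s i) = 0" "ip (s i) q = 1" for i
    using assms(3) by (simp_all add: isothermic_net_def space_form_def lorentz_quadric_def
        affine_hyperplane_def del: split_paired_All)
  have n: "ip (n i) (n i) = 1" "ip (n i) (s i) = 0" "ip (n i) q = 0" for i
    using assms(4) by (simp_all add: gauss_map_def tangent_space_def orth_compl_def
        del: split_paired_All)
  \<comment> \<open>Tangency of \<open>n i\<close> kills the cross terms and \<open>s i\<close> is
    lightlike, so only \<open>ip (n i) (n i)\<close> survives; against \<open>q\<close>, only the
    \<open>s i\<close> part contributes. This fixes the witnesses \<open>r = H\<close> and
    \<open>t = 1\<close>.\<close>
  have zz: "ip (z i) (z i) = 1" and zq: "ip (z i) q = H" for i
    using s n sym[of "s i" "n i"] by (simp_all add: z_def bilinear_simps)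
  have "z i \<noteq> 0" for i
    using zz[of i] bilinear_lzero[OF bil] by force
  then have "homogeneous_lift (mean_curvature_sphere_congruence s n H) z"
    by (simp add: homogeneous_lift_def mean_curvature_sphere_congruence_def z_def)
  moreover have "koenigs_dual s z"
  proof (rule edge_parallel_imp_koenigs_dual)
    show "conjugate_net s"
      using assms(3) by (simp add: isothermic_net_def koenigs_net_def)
  next
    fix i j
    assume "edge i j"
    then obtain k where "diff n i j + k *\<^sub>R diff s i j = 0"
      using assms(4) unfolding gauss_map_def by blast
    then have "diff n i j = - (k *\<^sub>R diff s i j)"
      by (simp add: eq_neg_iff_add_eq_0)
    moreover have "diff z i j = diff n i j + H *\<^sub>R diff s i j"
      by (simp add: diff_def z_def algebra_simps)
    \<comment> \<open>The factor is \<open>H\<close> minus the curvature of the edge and may vary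
      from edge to edge.\<close>
    ultimately have "diff z i j = (H - k) *\<^sub>R diff s i j"
      by (simp add: algebra_simps)
    then show "\<exists>c. diff z i j = c *\<^sub>R diff s i j" ..
  next
    fix i j k l
    assume "face i j k l"
    then show "mixed_area z s i j k l = 0"
      using assms(5) unfolding z_def mixed_area_add_scaleR_left constant_mean_curvature_def by blast
  qed
  moreover have "z i \<in> concentric_quadric ip q H 1" for i
    using zz zq by (simp add: concentric_quadric_def lorentz_quadric_def affine_hyperplane_def)
  ultimately show ?thesis
    unfolding z_def Let_def by blast
qed

end
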